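(* There are no maximal Lagrangian surfaces in $\mathbb{L}(\mathbb{H}^3)$ of rank one.
   Context: $\mathbb{L}(\mathbb{H}^3)$ denotes the space of oriented geodesics of hyperbolic 3-space $\mathbb{H}^3$, identified with $\mathbb{P}^1\times\mathbb{P}^1-\overline{\Delta}$, where in holomorphic coordinates $(\mu_1,\mu_2)$ one has $\overline{\Delta}=\{\mu_1\bar\mu_2=-1\}$. (In the upper half-space model $\{(z,t): z\in\mathbb{C},\,t>0\}$ the oriented geodesic $(\mu_1,\mu_2)$ begins at the boundary point $z=-\mu_1$ and ends at $z=1/\bar\mu_2$.) It carries the symplectic form $$\Omega=-\left[\frac{d\mu_1\wedge d\bar\mu_2}{(1+\mu_1\bar\mu_2)^2}+\frac{d\bar\mu_1\wedge d\mu_2}{(1+\bar\mu_1\mu_2)^2}\right]$$ and the neutral (signature $++--$) Kähler metric $$\mathbb{G}=-i\left[\frac{d\mu_1\, d\bar\mu_2}{(1+\mu_1\bar\mu_2)^2}-\frac{d\bar\mu_1\, d\mu_2}{(1+\bar\mu_1\mu_2)^2}\right]$$ (symmetric products). Surfaces are smooth immersed real 2-dimensional surfaces. A surface is Lagrangian if $\Omega$ pulls back to zero on it. It is maximal if it is stationary for the area functional of the metric induced by $\mathbb{G}$ under compactly supported variations (equivalently, its mean curvature vector vanishes). The rank of an immersion $f:\Sigma\to\mathbb{L}(\mathbb{H}^3)$ at a point is the real rank (0, 1 or 2) there of $(\pi\circ f)_*:T\Sigma\to T\mathbb{P}^1$, where $\pi$ is projection onto the first factor $\mu_1$. A surface is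 of rank one if this rank is 1 at every point. *)

theory Defs
  imports "HOL-Analysis.Analysis"
begin

subsection \<open>Smooth maps and smooth surfaces\<close>

text \<open>\<open>Ck_on k f S\<close> is meant for open \<open>S\<close> in a finite-dimensional space.\<close>

primrec Ck_on ::
  "nat \<Rightarrow> ('a::real_normed_vector \<Rightarrow> 'b::real_normed_vector) \<Rightarrow> 'a set \<Rightarrow> bool" where
  "Ck_on 0 f S \<longleftrightarrow> continuous_on S f"
| "Ck_on (Suc k) f S \<longleftrightarrow>
     (\<forall>x\<in>S. f differentiable at x) \<and> (\<forall>v. Ck_on k (\<lambda>x. frechet_derivative f (at x) v) S)"

definition smooth_on ::
  "('a::real_normed_vector \<Rightarrow> 'b::real_normed_vector) \<Rightarrow> 'a set \<Rightarrow> bool" where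
  "smooth_on f S \<longleftrightarrow> (\<forall>k. Ck_on k f S)"

type_synonym 'a chart = "'a set \<times> ('a \<Rightarrow> real ^ 2)"

text \<open>A nonempty (not necessarily connected) smooth 2-manifold without boundary, with a smooth
  atlas \<open>A\<close>. The map of a chart \<open>(U, \<phi>)\<close> is only relevant on \<open>U\<close>.\<close>

definition smooth_surface :: "'a topology \<Rightarrow> 'a chart set \<Rightarrow> bool" where
  "smooth_surface X A \<longleftrightarrow>
     topspace X \<noteq> {} \<and> Hausdorff_space X \<and> second_countable X \<and>
     (\<Union>(U, \<phi>)\<in>A. U) = topspace X \<and>
     (\<forall>(U, \<phi>)\<in>A. openin X U \<and> open (\<phi> ` U) \<and>
        homeomorphic_map (subtopology X U) (top_of_set (\<phi> ` U)) \<phi>) \<and>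
     (\<forall>(U, \<phi>)\<in>A. \<forall>(V, \<psi>)\<in>A. smooth_on (\<psi> \<circ> inv_into U \<phi>) (\<phi> ` (U \<inter> V)))"


subsection \<open>The space of oriented geodesics of hyperbolic 3-space\<close>

text \<open>The complex projective line is \<open>\<complex> \<union> {\<infinity>}\<close>, with \<open>None\<close> as the point at infinity.\<close>

type_synonym cp1 = "complex option"

text \<open>The closure of \<open>{\<mu>\<^sub>1 cnj \<mu>\<^sub>2 = -1}\<close>. It is the locus where the would-be endpoints
  \<open>-\<mu>\<^sub>1\<close> and \<open>1 / cnj \<mu>\<^sub>2\<close> of the geodesic coincide, which adds two points at infinity.\<close>

definition reflected_diagonal :: "(cp1 \<times> cp1) set" where
  "reflected_diagonal =
     {(Some m1, Some m2) | m1 m2. m1 * cnj m2 = -1} \<union> {(None, Some 0), (Some 0, None)}"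

definition LH3 :: "(cp1 \<times> cp1) set" where
  "LH3 = UNIV - reflected_diagonal"

text \<open>Two affine coordinates on the projective line: \<open>\<mu>\<close> around \<open>0\<close>, and \<open>1 / \<mu>\<close> around
  infinity.\<close>

datatype pole = Origin | Infinity

fun affine_coord :: "pole \<Rightarrow> cp1 \<Rightarrow> complex" where
  "affine_coord Origin (Some m) = m"
| "affine_coord Origin None = 0"
| "affine_coord Infinity (Some m) = inverse m"
| "affine_coord Infinity None = 0"

fun affine_dom :: "pole \<Rightarrow> cp1 set" where
  "affine_dom Origin = - {None}"
| "affine_dom Infinity = - {Some 0}"

text \<open>On \<open>LH3\<close> it suffices to use the same kind of affine coordinate on both factors: a point of
  \<open>LH3\<close> with one coordinate at infinity has its other coordinate nonzero
  (lemma \<open>LH3_eq_Un_geo_dom\<close>).\<close>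

definition geo_dom :: "pole \<Rightarrow> (cp1 \<times> cp1) set" where
  "geo_dom c = LH3 \<inter> affine_dom c \<times> affine_dom c"

definition geo_coord :: "pole \<Rightarrow> cp1 \<times> cp1 \<Rightarrow> complex \<times> complex" where
  "geo_coord c = map_prod (affine_coord c) (affine_coord c)"

lemma LH3_eq_Un_geo_dom: "LH3 = geo_dom Origin \<union> geo_dom Infinity"
  by (auto simp: LH3_def geo_dom_def reflected_diagonal_def)

lemma geo_coord_image: "geo_coord c ` geo_dom c = {(m1, m2). 1 + m1 * cnj m2 \<noteq> 0}"
proof (cases c)
  case Origin
  show ?thesis
  proof (intro set_eqI iffI)
    fix p assume "p \<in> geo_coord c ` geo_dom c"
    then show "p \<in> {(m1, m2). 1 + m1 * cnj m2 \<noteq> 0}"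
      using Origin
      by (auto simp: geo_coord_def geo_dom_def LH3_def reflected_diagonal_def add_eq_0_iff)
  next
    fix p :: "complex \<times> complex" assume p: "p \<in> {(m1, m2). 1 + m1 * cnj m2 \<noteq> 0}"
    have "p = geo_coord c (Some (fst p), Some (snd p))"
      using Origin by (simp add: geo_coord_def)
    moreover have "(Some (fst p), Some (snd p)) \<in> geo_dom c"
      using p Origin by (auto simp: geo_dom_def LH3_def reflected_diagonal_def add_eq_0_iff)
    ultimately show "p \<in> geo_coord c ` geo_dom c" by blast
  qed
next
  case Infinity
  define j :: "complex \<Rightarrow> cp1" where "j m = (if m = 0 then None else Some (inverse m))" for m
  have neg: "- z = 1 \<longleftrightarrow> z = -1" for z :: complex by (metis minus_minus)
  have inv: "a * cnj b = -1" if "a * m1 = 1" "b * m2 = 1" "m1 * cnj m2 = -1" for a b m1 m2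
  proof -
    have "(a * cnj b) * (m1 * cnj m2) = (a * m1) * cnj (b * m2)" by simp
    then show ?thesis using that by (simp add: neg)
  qed
  show ?thesis
  proof (intro set_eqI iffI)
    fix p assume "p \<in> geo_coord c ` geo_dom c"
    then obtain q r where qr: "(q, r) \<in> geo_dom c" "p = geo_coord c (q, r)" by auto
    then show "p \<in> {(m1, m2). 1 + m1 * cnj m2 \<noteq> 0}"
      using Infinity
      by (cases q; cases r)
        (auto simp: geo_coord_def geo_dom_def LH3_def reflected_diagonal_def field_simps
          add_eq_0_iff neg)
  next
    fix p :: "complex \<times> complex" assume p: "p \<in> {(m1, m2). 1 + m1 * cnj m2 \<noteq> 0}"
    have "p = geo_coord c (j (fst p), j (snd p))"
      using Infinity by (cases p) (auto simp: geo_coord_def j_def)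
    moreover have "(j (fst p), j (snd p)) \<in> geo_dom c"
      using p Infinity
      by (cases p) (auto simp: geo_dom_def LH3_def reflected_diagonal_def j_def field_simps
          add_eq_0_iff neg split: if_splits dest: inv)
    ultimately show "p \<in> geo_coord c ` geo_dom c" by blast
  qed
qed

definition wedge :: "('v \<Rightarrow> complex) \<Rightarrow> ('v \<Rightarrow> complex) \<Rightarrow> 'v \<Rightarrow> 'v \<Rightarrow> complex" where
  "wedge \<alpha> \<beta> u v = \<alpha> u * \<beta> v - \<beta> u * \<alpha> v"

definition sym_prod :: "('v \<Rightarrow> complex) \<Rightarrow> ('v \<Rightarrow> complex) \<Rightarrow> 'v \<Rightarrow> 'v \<Rightarrow> complex" where
  "sym_prod \<alpha> \<beta> u v = (\<alpha> u * \<beta> v + \<beta> u * \<alpha> v) / 2"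

abbreviation d\<mu>1 :: "complex \<times> complex \<Rightarrow> complex" where "d\<mu>1 \<equiv> fst"
abbreviation d\<mu>2 :: "complex \<times> complex \<Rightarrow> complex" where "d\<mu>2 \<equiv> snd"
abbreviation d\<mu>1_bar :: "complex \<times> complex \<Rightarrow> complex" where "d\<mu>1_bar \<equiv> (\<lambda>u. cnj (fst u))"
abbreviation d\<mu>2_bar :: "complex \<times> complex \<Rightarrow> complex" where "d\<mu>2_bar \<equiv> (\<lambda>u. cnj (snd u))"

text \<open>The symplectic form and the neutral metric at the point with coordinates \<open>m\<close>. The complex
  expressions are real already, and \<open>Re\<close> only changes the type. The same formulas hold in the
  coordinates \<open>(\<mu>\<^sub>1, \<mu>\<^sub>2)\<close> and \<open>(1/\<mu>\<^sub>1, 1/\<mu>\<^sub>2)\<close>; see \<open>symplectic_form_inversion\<close> and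
  \<open>neutral_metric_inversion\<close>.\<close>

definition symplectic_form ::
  "complex \<times> complex \<Rightarrow> complex \<times> complex \<Rightarrow> complex \<times> complex \<Rightarrow> real" where
  "symplectic_form m u v = Re (-
     (wedge d\<mu>1 d\<mu>2_bar u v / (1 + fst m * cnj (snd m))\<^sup>2
      + wedge d\<mu>1_bar d\<mu>2 u v / (1 + cnj (fst m) * snd m)\<^sup>2))"

definition neutral_metric ::
  "complex \<times> complex \<Rightarrow> complex \<times> complex \<Rightarrow> complex \<times> complex \<Rightarrow> real" where
  "neutral_metric m u v = Re (- \<i> *
     (sym_prod d\<mu>1 d\<mu>2_bar u v / (1 + fst m * cnj (snd m))\<^sup>2
      - sym_prod d\<mu>1_bar d\<mu>2 u v / (1 + cnj (fst m) * snd m)\<^sup>2))"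

lemma inversion_aux:
  fixes a b x y :: complex
  assumes "a \<noteq> 0" "b \<noteq> 0"
  shows "(- x / a\<^sup>2) * (- y / b\<^sup>2) / (1 + inverse a * inverse b)\<^sup>2 = x * y / (1 + a * b)\<^sup>2"
proof -
  have "(1 + a * b)\<^sup>2 = a\<^sup>2 * b\<^sup>2 * (1 + inverse a * inverse b)\<^sup>2"
    using assms by (simp add: field_simps power2_eq_square)
  then show ?thesis using assms by simp
qed

lemma
  fixes m u v :: "complex \<times> complex"
  assumes "fst m \<noteq> 0" "snd m \<noteq> 0"
  defines "m' \<equiv> map_prod inverse inverse m"
    and "D \<equiv> \<lambda>w. (- fst w / (fst m)\<^sup>2, - snd w / (snd m)\<^sup>2)"
  shows symplectic_form_inversion: "symplectic_form m' (D u) (D v) = symplectic_form m u v"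
    and neutral_metric_inversion: "neutral_metric m' (D u) (D v) = neutral_metric m u v"
proof -
  have *: "(- x / (fst m)\<^sup>2) * (- y / (cnj (snd m))\<^sup>2)
        / (1 + inverse (fst m) * inverse (cnj (snd m)))\<^sup>2 = x * y / (1 + fst m * cnj (snd m))\<^sup>2"
    "(- y / (cnj (snd m))\<^sup>2) * (- x / (fst m)\<^sup>2)
        / (1 + inverse (fst m) * inverse (cnj (snd m)))\<^sup>2 = y * x / (1 + fst m * cnj (snd m))\<^sup>2"
    "(- x / (cnj (fst m))\<^sup>2) * (- y / (snd m)\<^sup>2)
        / (1 + inverse (cnj (fst m)) * inverse (snd m))\<^sup>2 = x * y / (1 + cnj (fst m) * snd m)\<^sup>2"
    "(- y / (snd m)\<^sup>2) * (- x / (cnj (fst m))\<^sup>2)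
        / (1 + inverse (cnj (fst m)) * inverse (snd m))\<^sup>2 = y * x / (1 + cnj (fst m) * snd m)\<^sup>2"
    for x y
    using inversion_aux[of "fst m" "cnj (snd m)" x y] inversion_aux[of "cnj (fst m)" "snd m" x y]
      assms by (simp_all only: mult.commute complex_cnj_zero_iff not_False_eq_True)
  have cnj_D: "cnj (- x / m\<^sup>2) = - cnj x / (cnj m)\<^sup>2" for x m by simp
  have W: "wedge d\<mu>1 d\<mu>2_bar (D u) (D v) / (1 + fst m' * cnj (snd m'))\<^sup>2
      = wedge d\<mu>1 d\<mu>2_bar u v / (1 + fst m * cnj (snd m))\<^sup>2"
    "wedge d\<mu>1_bar d\<mu>2 (D u) (D v) / (1 + cnj (fst m') * snd m')\<^sup>2
      = wedge d\<mu>1_bar d\<mu>2 u v / (1 + cnj (fst m) * snd m)\<^sup>2"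
    unfolding wedge_def m'_def D_def fst_conv snd_conv fst_map_prod snd_map_prod
      complex_cnj_inverse cnj_D diff_divide_distrib * by (rule refl)+
  have S: "sym_prod d\<mu>1 d\<mu>2_bar (D u) (D v) / (1 + fst m' * cnj (snd m'))\<^sup>2
      = sym_prod d\<mu>1 d\<mu>2_bar u v / (1 + fst m * cnj (snd m))\<^sup>2"
    "sym_prod d\<mu>1_bar d\<mu>2 (D u) (D v) / (1 + cnj (fst m') * snd m')\<^sup>2
      = sym_prod d\<mu>1_bar d\<mu>2 u v / (1 + cnj (fst m) * snd m)\<^sup>2"
    unfolding sym_prod_def m'_def D_def fst_conv snd_conv fst_map_prod snd_map_prod
      complex_cnj_inverse cnj_D divide_divide_eq_left mult.commute[of 2 "_\<^sup>2"]
    unfolding divide_divide_eq_left[symmetric] add_divide_distrib * by (rule refl)+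
  show "symplectic_form m' (D u) (D v) = symplectic_form m u v"
    unfolding symplectic_form_def W ..
  show "neutral_metric m' (D u) (D v) = neutral_metric m u v"
    unfolding neutral_metric_def S ..
qed


subsection \<open>The Levi-Civita connection and the mean curvature vector\<close>

text \<open>Christoffel symbols of the first kind, contracted with three tangent vectors:
  \<open>G(\<Gamma>(u, v), w)\<close>.\<close>

definition christoffel1 ::
  "complex \<times> complex \<Rightarrow> complex \<times> complex \<Rightarrow> complex \<times> complex \<Rightarrow> complex \<times> complex \<Rightarrow> real" where
  "christoffel1 m u v w =
     (frechet_derivative (\<lambda>p. neutral_metric p v w) (at m) u
      + frechet_derivative (\<lambda>p. neutral_metric p u w) (at m) v
      - frechet_derivative (\<lambda>p. neutral_metric p u v) (at m) w) / 2"

text \<open>Below, \<open>F\<close> is a surface in coordinates: a map from (an open subset of) the plane to the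
  coordinate space of \<open>LH3\<close>.\<close>

definition partial_deriv :: "(real ^ 2 \<Rightarrow> 'b::real_normed_vector) \<Rightarrow> 2 \<Rightarrow> real ^ 2 \<Rightarrow> 'b" where
  "partial_deriv F i y = frechet_derivative F (at y) (axis i 1)"

text \<open>The covariant derivative of \<open>\<partial>\<^sub>j F\<close> in direction \<open>\<partial>\<^sub>i F\<close>; it is unique since the neutral
  metric is nondegenerate.\<close>

definition cov_deriv ::
  "(real ^ 2 \<Rightarrow> complex \<times> complex) \<Rightarrow> 2 \<Rightarrow> 2 \<Rightarrow> real ^ 2 \<Rightarrow> complex \<times> complex" where
  "cov_deriv F i j y = (THE W. \<forall>w. neutral_metric (F y) W w =
     neutral_metric (F y) (partial_deriv (partial_deriv F j) i y) w
     + christoffel1 (F y) (partial_deriv F i y) (partial_deriv F j y) w)"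

definition induced_metric :: "(real ^ 2 \<Rightarrow> complex \<times> complex) \<Rightarrow> real ^ 2 \<Rightarrow> real ^ 2 ^ 2" where
  "induced_metric F y =
     (\<chi> i j. neutral_metric (F y) (partial_deriv F i y) (partial_deriv F j y))"

definition normal_part ::
  "(real ^ 2 \<Rightarrow> complex \<times> complex) \<Rightarrow> real ^ 2 \<Rightarrow> complex \<times> complex \<Rightarrow> complex \<times> complex" where
  "normal_part F y V = V - (\<Sum>i\<in>UNIV. \<Sum>j\<in>UNIV.
     (matrix_inv (induced_metric F y) $ i $ j * neutral_metric (F y) V (partial_deriv F i y))
       *\<^sub>R partial_deriv F j y)"

definition second_fundamental_form ::
  "(real ^ 2 \<Rightarrow> complex \<times> complex) \<Rightarrow> 2 \<Rightarrow> 2 \<Rightarrow> real ^ 2 \<Rightarrow> complex \<times> complex" where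
  "second_fundamental_form F i j y = normal_part F y (cov_deriv F i j y)"

definition mean_curvature_vector ::
  "(real ^ 2 \<Rightarrow> complex \<times> complex) \<Rightarrow> real ^ 2 \<Rightarrow> complex \<times> complex" where
  "mean_curvature_vector F y = (1/2) *\<^sub>R (\<Sum>i\<in>UNIV. \<Sum>j\<in>UNIV.
     matrix_inv (induced_metric F y) $ i $ j *\<^sub>R second_fundamental_form F i j y)"


subsection \<open>Surfaces in the space of oriented geodesics\<close>

text \<open>The coordinate representation of \<open>f\<close> in the chart \<open>(U, \<phi>)\<close> of the surface and the coordinates
  \<open>c\<close> of \<open>LH3\<close>, and its domain.\<close>

definition coord_rep ::
  "('a \<Rightarrow> cp1 \<times> cp1) \<Rightarrow> 'a chart \<Rightarrow> pole \<Rightarrow> real ^ 2 \<Rightarrow> complex \<times> complex" where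
  "coord_rep f k c = geo_coord c \<circ> f \<circ> inv_into (fst k) (snd k)"

definition coord_dom :: "('a \<Rightarrow> cp1 \<times> cp1) \<Rightarrow> 'a chart \<Rightarrow> pole \<Rightarrow> (real ^ 2) set" where
  "coord_dom f k c = snd k ` (fst k \<inter> f -` geo_dom c)"

text \<open>Openness of the domains amounts to continuity of \<open>f\<close>.\<close>

definition smooth_map_LH3 :: "'a topology \<Rightarrow> 'a chart set \<Rightarrow> ('a \<Rightarrow> cp1 \<times> cp1) \<Rightarrow> bool" where
  "smooth_map_LH3 X A f \<longleftrightarrow> f ` topspace X \<subseteq> LH3 \<and>
     (\<forall>k\<in>A. \<forall>c. open (coord_dom f k c) \<and> smooth_on (coord_rep f k c) (coord_dom f k c))"

definition immersion_LH3 :: "'a topology \<Rightarrow> 'a chart set \<Rightarrow> ('a \<Rightarrow> cp1 \<times> cp1) \<Rightarrow> bool" where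
  "immersion_LH3 X A f \<longleftrightarrow> smooth_map_LH3 X A f \<and>
     (\<forall>k\<in>A. \<forall>c. \<forall>y\<in>coord_dom f k c. inj (frechet_derivative (coord_rep f k c) (at y)))"

definition lagrangian :: "'a chart set \<Rightarrow> ('a \<Rightarrow> cp1 \<times> cp1) \<Rightarrow> bool" where
  "lagrangian A f \<longleftrightarrow> (\<forall>k\<in>A. \<forall>c. \<forall>y\<in>coord_dom f k c. \<forall>u v.
     symplectic_form (coord_rep f k c y)
       (frechet_derivative (coord_rep f k c) (at y) u)
       (frechet_derivative (coord_rep f k c) (at y) v) = 0)"

text \<open>The mean curvature vector is only defined where the induced metric is nondegenerate.\<close>

definition maximal :: "'a chart set \<Rightarrow> ('a \<Rightarrow> cp1 \<times> cp1) \<Rightarrow> bool" where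
  "maximal A f \<longleftrightarrow> (\<forall>k\<in>A. \<forall>c. \<forall>y\<in>coord_dom f k c.
     invertible (induced_metric (coord_rep f k c) y) \<and>
     mean_curvature_vector (coord_rep f k c) y = 0)"

text \<open>The real rank of the differential of the first component; \<open>affine_coord c\<close> is a coordinate of
  the first projective line near the point in question. \<open>x\<close> is a point of the surface.\<close>

definition has_rank_at :: "'a chart set \<Rightarrow> ('a \<Rightarrow> cp1 \<times> cp1) \<Rightarrow> 'a \<Rightarrow> nat \<Rightarrow> bool" where
  "has_rank_at A f x r \<longleftrightarrow> (\<forall>k\<in>A. \<forall>c. x \<in> fst k \<and> f x \<in> geo_dom c \<longrightarrow>
     dim (range (frechet_derivative (\<lambda>y. fst (coord_rep f k c y)) (at (snd k x)))) = r)"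

definition of_rank :: "'a topology \<Rightarrow> 'a chart set \<Rightarrow> ('a \<Rightarrow> cp1 \<times> cp1) \<Rightarrow> nat \<Rightarrow> bool" where
  "of_rank X A f r \<longleftrightarrow> (\<forall>x\<in>topspace X. has_rank_at A f x r)"

end

theory Submission
  imports Defs
begin

text \<open>Write \<open>z = \<mu>\<^sub>1\<close>, \<open>w = cnj \<mu>\<^sub>2\<close> and \<open>s = 1 + z w\<close>. The metric is twice the imaginary part of the holomorphic
  metric \<open>dz dw / s\<^sup>2\<close>, and the symplectic form is minus twice the real part of \<open>(dz \<and> dw) / s\<^sup>2\<close>; so the
  Levi-Civita connection acts on \<open>z\<close> and \<open>w\<close> separately.

  On a surface of rank one the two partial derivatives of \<open>z\<close> are real multiples of each other, say
  \<open>z\<^sub>2 = r z\<^sub>1\<close> with \<open>r\<close> real and \<open>z\<^sub>1 \<noteq> 0\<close>. Then \<open>z\<close> is constant along \<open>V = \<partial>\<^sub>2 - r \<partial>\<^sub>1\<close>, and \<open>V\<close> is a null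
  field. The number \<open>P = (z\<^sub>1 w\<^sub>2 - z\<^sub>2 w\<^sub>1) / s\<^sup>2\<close> is imaginary because the surface is Lagrangian, and nonzero
  because its imaginary part is the metric product of \<open>\<partial>\<^sub>1\<close> and \<open>V\<close> and the induced metric is nondegenerate.

  Since \<open>V\<close> is null, the mean curvature vector is a combination of the normal parts of \<open>\<nabla>\<^sub>1 V\<close> and
  \<open>\<nabla>\<^sub>V V\<close>. On a Lagrangian surface normal parts are detected by the symplectic form. The term with
  \<open>\<nabla>\<^sub>V V\<close> drops out because \<open>P\<close> stays imaginary, and the mean curvature vanishes only if
  \<open>Im (z\<^sub>1\<^sub>1 / z\<^sub>1 - 2 w z\<^sub>1 / s) = 0\<close>. This says that the curve traced out by \<open>z\<close> is a geodesic, up to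
  parametrization, for the connection that the parameter \<open>w\<close> singles out. But \<open>w\<close> changes along \<open>V\<close> while the
  curve does not: differentiating the equation along \<open>V\<close> gives \<open>-2 Im P = 0\<close>, a contradiction. This is
  \<open>rank_one_jets_contradiction\<close>; it uses third derivatives of \<open>z\<close> and the symmetry of mixed partial
  derivatives (\<open>mixed_derivatives_commute\<close>). Working with the field \<open>V\<close> in arbitrary coordinates of the
  surface makes it unnecessary to choose coordinates in which \<open>V\<close> is a coordinate field.\<close>

section \<open>Symmetry of mixed derivatives\<close>

text \<open>The mean value theorem in direction \<open>u\<close>, applied to the increment of \<open>f\<close> in direction \<open>v\<close>, and
  then the mean value theorem in direction \<open>v\<close>. The second difference on the left is symmetric in \<open>u\<close>
  and \<open>v\<close>, which is what forces the two orders of differentiation to agree.\<close>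

lemma double_mean_value:
  fixes f fu fvu :: "'a::real_normed_vector \<Rightarrow> real"
  assumes f: "\<And>x. x \<in> ball y e \<Longrightarrow> \<exists>f'. (f has_derivative f') (at x) \<and> f' u = fu x"
    and fu: "\<And>x. x \<in> ball y e \<Longrightarrow> \<exists>f'. (fu has_derivative f') (at x) \<and> f' v = fvu x"
    and h: "0 < h" "h * (norm u + norm v) < e"
  shows "\<exists>x. dist y x \<le> h * (norm u + norm v) \<and>
    f (y + h *\<^sub>R u + h *\<^sub>R v) - f (y + h *\<^sub>R u) - f (y + h *\<^sub>R v) + f y = h\<^sup>2 * fvu x"
proof -
  have near: "dist y (y + a *\<^sub>R u + b *\<^sub>R v) \<le> h * (norm u + norm v)"
    if "a \<in> {0..h}" "b \<in> {0..h}" for a b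
  proof -
    have "dist y (y + a *\<^sub>R u + b *\<^sub>R v) = norm (a *\<^sub>R u + b *\<^sub>R v)"
      using norm_minus_cancel[of "a *\<^sub>R u + b *\<^sub>R v"] by (simp add: dist_norm algebra_simps)
    also have "\<dots> \<le> a * norm u + b * norm v"
      using that by (intro order_trans[OF norm_triangle_ineq]) simp
    also have "\<dots> \<le> h * norm u + h * norm v"
      using that by (intro add_mono mult_right_mono) auto
    finally show ?thesis by (simp add: distrib_left)
  qed
  have in_ball: "y + a *\<^sub>R u + b *\<^sub>R v \<in> ball y e" if "a \<in> {0..h}" "b \<in> {0..h}" for a b
    using near[OF that] h by simp
  have along: "((\<lambda>t. g (p + t *\<^sub>R q)) has_derivative (\<lambda>t. t * d)) (at a within T)"
    if g: "\<exists>g'. (g has_derivative g') (at (p + a *\<^sub>R q)) \<and> g' q = d"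
    for g :: "'a \<Rightarrow> real" and p q a d T
  proof -
    obtain g' where g': "(g has_derivative g') (at (p + a *\<^sub>R q))" "g' q = d"
      using g by blast
    have "((\<lambda>t. p + t *\<^sub>R q) has_derivative (\<lambda>t. t *\<^sub>R q)) (at a within T)"
      by (auto intro!: derivative_eq_intros)
    then have "((\<lambda>t. g (p + t *\<^sub>R q)) has_derivative (\<lambda>t. g' (t *\<^sub>R q))) (at a within T)"
      using g'(1) by (rule has_derivative_compose)
    then show ?thesis
      using g' has_derivative_linear[OF g'(1)] by (simp add: linear_cmul)
  qed
  define G where "G a = f ((y + h *\<^sub>R v) + a *\<^sub>R u) - f (y + a *\<^sub>R u)" for a
  have "(G has_derivative (\<lambda>t. t * (fu ((y + h *\<^sub>R v) + a *\<^sub>R u) - fu (y + a *\<^sub>R u))))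
      (at a within {0..h})" if a: "a \<in> {0..h}" for a
    unfolding G_def right_diff_distrib
    using in_ball[OF a, of h] in_ball[OF a, of 0] h
    by (intro has_derivative_diff along f) (auto simp: algebra_simps)
  from mvt_simple[OF h(1) this] obtain a where a: "a \<in> {0<..<h}"
    and Ga: "G h - G 0 = (h - 0) * (fu ((y + h *\<^sub>R v) + a *\<^sub>R u) - fu (y + a *\<^sub>R u))"
    by fastforce
  have "((\<lambda>b. fu ((y + a *\<^sub>R u) + b *\<^sub>R v)) has_derivative
      (\<lambda>t. t * fvu ((y + a *\<^sub>R u) + b *\<^sub>R v))) (at b within {0..h})" if b: "b \<in> {0..h}" for b
    using in_ball[OF _ b, of a] a by (intro along fu) auto
  from mvt_simple[OF h(1) this] obtain b where b: "b \<in> {0<..<h}"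
    and Gb: "fu ((y + a *\<^sub>R u) + h *\<^sub>R v) - fu ((y + a *\<^sub>R u) + 0 *\<^sub>R v)
      = (h - 0) * fvu ((y + a *\<^sub>R u) + b *\<^sub>R v)"
    by fastforce
  have "G h - G 0 = h\<^sup>2 * fvu (y + a *\<^sub>R u + b *\<^sub>R v)"
    using Ga Gb by (simp add: algebra_simps power2_eq_square)
  moreover have "G h - G 0
      = f (y + h *\<^sub>R u + h *\<^sub>R v) - f (y + h *\<^sub>R u) - f (y + h *\<^sub>R v) + f y"
    by (simp add: G_def add.commute add.left_commute)
  ultimately show ?thesis
    using near[of a b] a b by (intro exI[of _ "y + a *\<^sub>R u + b *\<^sub>R v"]) auto
qed

text \<open>On a parallelogram with edges \<open>h *\<^sub>R u\<close> and \<open>h *\<^sub>R v\<close> the second difference is \<open>h\<^sup>2\<close> times a value of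
  either mixed derivative; as \<open>h\<close> shrinks, continuity moves both values to \<open>y\<close>.\<close>

lemma mixed_derivatives_commute_real:
  fixes f fu fv fuv fvu :: "'a::real_normed_vector \<Rightarrow> real"
  assumes S: "open S" "y \<in> S"
    and fu: "\<And>x. x \<in> S \<Longrightarrow> \<exists>f'. (f has_derivative f') (at x) \<and> f' u = fu x"
    and fv: "\<And>x. x \<in> S \<Longrightarrow> \<exists>f'. (f has_derivative f') (at x) \<and> f' v = fv x"
    and fvu: "\<And>x. x \<in> S \<Longrightarrow> \<exists>f'. (fu has_derivative f') (at x) \<and> f' v = fvu x"
    and fuv: "\<And>x. x \<in> S \<Longrightarrow> \<exists>f'. (fv has_derivative f') (at x) \<and> f' u = fuv x"
    and cont: "continuous_on S fvu" "continuous_on S fuv"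
  shows "fvu y = fuv y"
proof (rule ccontr)
  assume "fvu y \<noteq> fuv y"
  define \<epsilon> where "\<epsilon> = \<bar>fvu y - fuv y\<bar> / 2"
  have \<epsilon>: "\<epsilon> > 0" using \<open>fvu y \<noteq> fuv y\<close> by (simp add: \<epsilon>_def)
  obtain e where e: "e > 0" "ball y e \<subseteq> S"
    using S by (meson openE)
  have "isCont fvu y" "isCont fuv y"
    using cont S by (simp_all add: continuous_on_eq_continuous_at)
  then obtain d1 d2 where d: "d1 > 0" "d2 > 0"
    and d1: "\<And>x. dist y x < d1 \<Longrightarrow> \<bar>fvu x - fvu y\<bar> < \<epsilon>"
    and d2: "\<And>x. dist y x < d2 \<Longrightarrow> \<bar>fuv x - fuv y\<bar> < \<epsilon>"
    using \<epsilon> unfolding continuous_at_eps_delta dist_real_def by (metis dist_commute)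
  define \<delta> where "\<delta> = min e (min d1 d2)"
  define h where "h = \<delta> / (norm u + norm v + 1)"
  have \<delta>: "\<delta> > 0" using e d by (simp add: \<delta>_def)
  have pos: "norm u + norm v + 1 > 0" by (simp add: add_nonneg_pos)
  have h: "h > 0" using \<delta> pos by (simp add: h_def)
  have "h * (norm u + norm v) < h * (norm u + norm v + 1)" using h by simp
  also have "\<dots> = \<delta>" using pos by (simp add: h_def)
  finally have small: "h * (norm u + norm v) < \<delta>" .
  have small': "h * (norm v + norm u) < \<delta>" using small by (simp add: add.commute)
  have "\<exists>x. dist y x \<le> h * (norm u + norm v) \<and>
    f (y + h *\<^sub>R u + h *\<^sub>R v) - f (y + h *\<^sub>R u) - f (y + h *\<^sub>R v) + f y = h\<^sup>2 * fvu x"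
    using e small h fu fvu unfolding \<delta>_def by (intro double_mean_value[of y e f u fu]) auto
  then obtain x where x: "dist y x < \<delta>"
    "f (y + h *\<^sub>R u + h *\<^sub>R v) - f (y + h *\<^sub>R u) - f (y + h *\<^sub>R v) + f y = h\<^sup>2 * fvu x"
    using small by (meson le_less_trans)
  have "\<exists>x. dist y x \<le> h * (norm v + norm u) \<and>
    f (y + h *\<^sub>R v + h *\<^sub>R u) - f (y + h *\<^sub>R v) - f (y + h *\<^sub>R u) + f y = h\<^sup>2 * fuv x"
    using e small' h fv fuv unfolding \<delta>_def by (intro double_mean_value[of y e f v fv]) auto
  then obtain x' where x': "dist y x' < \<delta>"
    "f (y + h *\<^sub>R v + h *\<^sub>R u) - f (y + h *\<^sub>R v) - f (y + h *\<^sub>R u) + f y = h\<^sup>2 * fuv x'"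
    using small' by (meson le_less_trans)
  have "y + h *\<^sub>R v + h *\<^sub>R u = y + h *\<^sub>R u + h *\<^sub>R v" by (simp add: algebra_simps)
  then have "h\<^sup>2 * fvu x = h\<^sup>2 * fuv x'" using x(2) x'(2) by (simp only:)
  then have "fvu x = fuv x'" using h by simp
  moreover have "\<bar>fvu x - fvu y\<bar> < \<epsilon>" "\<bar>fuv x' - fuv y\<bar> < \<epsilon>"
    using d1 d2 x(1) x'(1) by (simp_all add: \<delta>_def)
  ultimately show False unfolding \<epsilon>_def by (auto simp: abs_if split: if_splits)
qed

lemma Ck_on_SucD:
  assumes "Ck_on (Suc k) f S" "x \<in> S"
  shows "(f has_derivative frechet_derivative f (at x)) (at x)"
  using assms by (simp add: frechet_derivative_works)

lemma Ck_on_continuous: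
  assumes "Ck_on k f S" shows "continuous_on S f"
  using assms
  by (cases k) (auto intro!: continuous_at_imp_continuous_on differentiable_imp_continuous_within)

lemma mixed_derivatives_commute:
  fixes f :: "'a::real_normed_vector \<Rightarrow> 'b::euclidean_space"
  assumes f: "Ck_on (Suc (Suc k)) f S" and S: "open S" "y \<in> S"
  shows "frechet_derivative (\<lambda>x. frechet_derivative f (at x) u) (at y) v
       = frechet_derivative (\<lambda>x. frechet_derivative f (at x) v) (at y) u"
proof (rule euclidean_eqI)
  fix b :: 'b assume "b \<in> Basis"
  have f1: "Ck_on (Suc k) (\<lambda>x. frechet_derivative f (at x) u) S" for u
    using f by simp
  have f2: "Ck_on k (\<lambda>x. frechet_derivative (\<lambda>x. frechet_derivative f (at x) u) (at x) v) S" for u v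
    using f1[of u] by simp
  have inner_b: "\<exists>g'. ((\<lambda>x. g x \<bullet> b) has_derivative g') (at x) \<and> g' u = frechet_derivative g (at x) u \<bullet> b"
    if "Ck_on (Suc n) g S" "x \<in> S" for g :: "'a \<Rightarrow> 'b" and n x u
    using bounded_linear.has_derivative[OF bounded_linear_inner_left Ck_on_SucD[OF that]] by blast
  show "frechet_derivative (\<lambda>x. frechet_derivative f (at x) u) (at y) v \<bullet> b
      = frechet_derivative (\<lambda>x. frechet_derivative f (at x) v) (at y) u \<bullet> b"
    by (rule mixed_derivatives_commute_real[OF S])
      (rule inner_b f f1 continuous_on_inner continuous_on_const Ck_on_continuous[OF f2] | assumption)+
qed

section \<open>Partial derivatives in the plane\<close>

definition has_partial ::
  "(real ^ 2 \<Rightarrow> 'b::real_normed_vector) \<Rightarrow> 2 \<Rightarrow> 'b \<Rightarrow> real ^ 2 \<Rightarrow> bool" where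
  "has_partial f i d y \<longleftrightarrow> (\<exists>f'. (f has_derivative f') (at y) \<and> f' (axis i 1) = d)"

lemma has_partial_const: "d = 0 \<Longrightarrow> has_partial (\<lambda>y. c) i d y"
  unfolding has_partial_def by (blast intro: has_derivative_const)

lemma has_partial_add:
  assumes "has_partial f i a y" "has_partial g i b y" "d = a + b"
  shows "has_partial (\<lambda>y. f y + g y) i d y"
  using assms unfolding has_partial_def by (blast intro: has_derivative_add)

lemma has_partial_diff:
  assumes "has_partial f i a y" "has_partial g i b y" "d = a - b"
  shows "has_partial (\<lambda>y. f y - g y) i d y"
  using assms unfolding has_partial_def by (blast intro: has_derivative_diff)

lemma has_partial_mult:
  fixes f g :: "real ^ 2 \<Rightarrow> 'b::real_normed_field"
  assumes "has_partial f i a y" "has_partial g i b y" "d = f y * b + a * g y"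
  shows "has_partial (\<lambda>y. f y * g y) i d y"
  using assms unfolding has_partial_def by (blast intro: has_derivative_mult)

lemma has_partial_divide:
  fixes f g :: "real ^ 2 \<Rightarrow> 'b::real_normed_field"
  assumes "has_partial f i a y" "has_partial g i b y" "g y \<noteq> 0"
    "d = (a * g y - f y * b) / (g y * g y)"
  shows "has_partial (\<lambda>y. f y / g y) i d y"
  using assms unfolding has_partial_def by (blast intro: has_derivative_divide')

lemmas has_partial_rules =
  has_partial_const has_partial_add has_partial_diff has_partial_mult has_partial_divide

lemma has_partial_linear:
  assumes "bounded_linear L" "has_partial f i d y"
  shows "has_partial (\<lambda>y. L (f y)) i (L d) y"
  using assms unfolding has_partial_def by (blast intro: bounded_linear.has_derivative)

text \<open>A linear constraint on the values of \<open>f\<close>, for example that they are real, passes to its derivatives.\<close>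

lemma has_partial_linear_zero:
  assumes "bounded_linear L" "has_partial f i d y"
    and "open S" "y \<in> S" "\<And>x. x \<in> S \<Longrightarrow> L (f x) = 0"
  shows "L d = 0"
proof -
  obtain g' where g': "((\<lambda>y. L (f y)) has_derivative g') (at y)" "g' (axis i 1) = L d"
    using has_partial_linear[OF assms(1,2)] unfolding has_partial_def by blast
  have "((\<lambda>y. 0) has_derivative g') (at y)"
    using has_derivative_transform_within_open[OF g'(1) assms(3,4)] assms(5) by auto
  then have "g' = (\<lambda>h. 0)" using has_derivative_const has_derivative_unique by blast
  then show ?thesis using g'(2) by simp
qed

lemma has_partial_partial_deriv:
  assumes "Ck_on (Suc k) f S" "y \<in> S"
  shows "has_partial f i (partial_deriv f i y) y"
  using Ck_on_SucD[OF assms] unfolding has_partial_def partial_deriv_def by blast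

lemma Ck_on_partial_deriv: "Ck_on (Suc k) f S \<Longrightarrow> Ck_on k (partial_deriv f i) S"
  unfolding partial_deriv_def[abs_def] by simp

lemma partial_deriv_commute:
  fixes f :: "real ^ 2 \<Rightarrow> 'b::euclidean_space"
  assumes "Ck_on (Suc (Suc k)) f S" "open S" "y \<in> S"
  shows "partial_deriv (partial_deriv f i) j y = partial_deriv (partial_deriv f j) i y"
  unfolding partial_deriv_def[abs_def] by (rule mixed_derivatives_commute[OF assms])

section \<open>The jet computation\<close>

text \<open>The next two lemmas are the algebra of the covariant derivatives along the kernel field
  \<open>V = \<partial>\<^sub>2 - r \<partial>\<^sub>1\<close>, after \<open>z2\<close>, \<open>z12\<close> and \<open>z22\<close> have been eliminated with \<open>z2 = r z1\<close> and its
  derivatives. Both sides are rational functions of the remaining jet variables. With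
  \<open>P = (z1 w2 - z2 w1) / s\<^sup>2\<close>, the first one pairs \<open>\<nabla>\<^sub>1 V\<close> with the first coordinate vector and gives
  \<open>P c - \<partial>\<^sub>1 P\<close>, where \<open>c = z11 / z1 - 2 w z1 / s\<close>; the second one pairs \<open>\<nabla>\<^sub>V V\<close> with it and gives
  \<open>r \<partial>\<^sub>1 P - \<partial>\<^sub>2 P + (\<partial>\<^sub>1 r) P\<close>. All second derivatives of \<open>w\<close> are hidden in derivatives of \<open>P\<close>, whose
  real parts will vanish.\<close>

lemma vertical_derivative_mixed:
  fixes z w s z1 w1 w2 z11 w11 w12 r r1 :: complex
  assumes "s \<noteq> 0" "z1 \<noteq> 0"
  shows "((r1 * z1 + r * z11 - 2 * w * z1 * (r * z1) / s - r * (z11 - 2 * w * z1 * z1 / s)) * w1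
      - (w12 - 2 * z * w1 * w2 / s - r * (w11 - 2 * z * w1 * w1 / s)) * z1) / (s * s)
    = (z1 * w2 - r * z1 * w1) / (s * s) * (z11 / z1 - 2 * w * z1 / s)
      - ((z1 * w12 + z11 * w2 - (r * z1 * w11 + (r1 * z1 + r * z11) * w1)) * s
         - 2 * (z1 * w2 - r * z1 * w1) * (z * w1 + z1 * w)) / s ^ 3"
  using assms by (simp add: field_simps power3_eq_cube)

lemma vertical_derivative_twice:
  fixes z w s z1 w1 w2 z11 w11 w12 w22 r r1 r2 :: complex
  assumes "s \<noteq> 0"
  shows "((r2 * z1 + r * (r1 * z1 + r * z11) - 2 * w * (r * z1) * (r * z1) / s
        - 2 * r * (r1 * z1 + r * z11 - 2 * w * z1 * (r * z1) / s)
        + r * r * (z11 - 2 * w * z1 * z1 / s)) * w1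
      - (w22 - 2 * z * w2 * w2 / s - 2 * r * (w12 - 2 * z * w1 * w2 / s)
        + r * r * (w11 - 2 * z * w1 * w1 / s)) * z1) / (s * s)
    = r * (((z1 * w12 + z11 * w2 - (r * z1 * w11 + (r1 * z1 + r * z11) * w1)) * s
         - 2 * (z1 * w2 - r * z1 * w1) * (z * w1 + z1 * w)) / s ^ 3)
      - ((z1 * w22 + (r1 * z1 + r * z11) * w2 - (r * z1 * w12 + (r2 * z1 + r * (r1 * z1 + r * z11)) * w1)) * s
         - 2 * (z1 * w2 - r * z1 * w1) * (z * w2 + r * z1 * w)) / s ^ 3
      + r1 * ((z1 * w2 - r * z1 * w1) / (s * s))"
  using assms by (simp add: field_simps power3_eq_cube)

text \<open>The computation at the heart of the proof, in the coordinates \<open>z = \<mu>\<^sub>1\<close> and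
  \<open>w = cnj \<mu>\<^sub>2\<close>.
  The families \<open>zd\<close>, \<open>zdd\<close> and \<open>z111\<close>, \<open>z112\<close> are the partial derivatives of \<open>z\<close> of order one, two and
  three; \<open>g\<close> is the induced metric, and \<open>b k l\<close> is, up to a constant factor, the symplectic pairing of
  \<open>\<nabla>\<^sub>k \<partial>\<^sub>l F\<close> with \<open>\<partial>\<^sub>i F\<close>, so that \<open>H\<close> is one component of the vanishing of the mean curvature.

  As the kernel field \<open>V = \<partial>\<^sub>j - r \<partial>\<^sub>i\<close> is null, the trace with respect to \<open>g\<close> only involves \<open>\<nabla>\<^sub>i V\<close> and
  \<open>\<nabla>\<^sub>V V\<close>. The latter pairs to zero since \<open>P\<close> and its derivatives are imaginary, and the former
  leaves \<open>Im c = 0\<close>. One more derivative along \<open>V\<close> gives \<open>Im P = 0\<close>, which contradicts the nondegeneracy of \<open>g\<close>.\<close>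

lemma rank_one_jets_contradiction:
  fixes z w s z111 z112 :: "real ^ 2 \<Rightarrow> complex"
    and zd wd :: "2 \<Rightarrow> real ^ 2 \<Rightarrow> complex"
    and zdd wdd :: "2 \<Rightarrow> 2 \<Rightarrow> real ^ 2 \<Rightarrow> complex"
    and g b :: "2 \<Rightarrow> 2 \<Rightarrow> real ^ 2 \<Rightarrow> real"
  assumes s_def: "s = (\<lambda>y. 1 + z y * w y)"
    and g: "\<And>k l y. y \<in> S \<Longrightarrow>
      g k l y = Im ((zd k y * wd l y + zd l y * wd k y) / (s y * s y))"
    and b: "\<And>k l y. y \<in> S \<Longrightarrow>
      b k l y = Re (((zdd k l y - 2 * w y * zd k y * zd l y / s y) * wd i y
        - (wdd k l y - 2 * z y * wd k y * wd l y / s y) * zd i y) / (s y * s y))"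
    and S: "open S" "y0 \<in> S"
    and nz: "\<And>y. y \<in> S \<Longrightarrow> s y \<noteq> 0" "\<And>y. y \<in> S \<Longrightarrow> zd i y \<noteq> 0"
    and d: "\<And>k y. y \<in> S \<Longrightarrow> has_partial z k (zd k y) y"
      "\<And>k y. y \<in> S \<Longrightarrow> has_partial w k (wd k y) y"
    and dd: "\<And>k l y. y \<in> S \<Longrightarrow> has_partial (zd l) k (zdd k l y) y"
      "\<And>k l y. y \<in> S \<Longrightarrow> has_partial (wd l) k (wdd k l y) y"
    and commute: "\<And>k l y. y \<in> S \<Longrightarrow> zdd k l y = zdd l k y"
      "\<And>k l y. y \<in> S \<Longrightarrow> wdd k l y = wdd l k y"
    and ddd: "\<And>y. y \<in> S \<Longrightarrow> has_partial (zdd i i) i (z111 y) y"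
      "\<And>y. y \<in> S \<Longrightarrow> has_partial (zdd i i) j (z112 y) y"
      "\<And>y. y \<in> S \<Longrightarrow> has_partial (zdd j i) i (z112 y) y"
    and rank: "\<And>y. y \<in> S \<Longrightarrow> Im (zd j y / zd i y) = 0"
    and lagrangian: "\<And>y. y \<in> S \<Longrightarrow> Re ((zd i y * wd j y - zd j y * wd i y) / (s y * s y)) = 0"
    and nondegenerate: "\<And>y. y \<in> S \<Longrightarrow> g i i y * g j j y \<noteq> (g i j y)\<^sup>2"
    and H: "\<And>y. y \<in> S \<Longrightarrow>
      g j j y * b i i y - 2 * g i j y * b j i y + g i i y * b j j y = 0"
  shows False
proof -
  define z1 z2 w1 w2 where "z1 = zd i" and "z2 = zd j" and "w1 = wd i" and "w2 = wd j"
  define z11 z12 z22 where "z11 = zdd i i" and "z12 = zdd j i" and "z22 = zdd j j"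
  define w11 w12 w22 where "w11 = wdd i i" and "w12 = wdd j i" and "w22 = wdd j j"
  note jet_defs = z1_def z2_def w1_def w2_def z11_def z12_def z22_def w11_def w12_def w22_def
  have dd_mixed: "has_partial z2 i (z12 y) y" "has_partial w2 i (w12 y) y" if "y \<in> S" for y
    unfolding jet_defs commute[OF that, of j i] by (rule dd[OF that])+
  have D: "has_partial z i (z1 y) y" "has_partial z j (z2 y) y"
    "has_partial w i (w1 y) y" "has_partial w j (w2 y) y"
    "has_partial z1 i (z11 y) y" "has_partial z1 j (z12 y) y"
    "has_partial z2 i (z12 y) y" "has_partial z2 j (z22 y) y"
    "has_partial w1 i (w11 y) y" "has_partial w1 j (w12 y) y"
    "has_partial w2 i (w12 y) y" "has_partial w2 j (w22 y) y"
    "has_partial z11 i (z111 y) y" "has_partial z11 j (z112 y) y" "has_partial z12 i (z112 y) y"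
    if "y \<in> S" for y
    using d[OF that] dd[OF that] dd_mixed[OF that] ddd[OF that] by (simp_all add: jet_defs)
  note nz = nz[folded jet_defs]
  define Az where "Az a b c y = c y - 2 * w y * a y * b y / s y" for a b c :: "real ^ 2 \<Rightarrow> complex" and y
  define Aw where "Aw a b c y = c y - 2 * z y * a y * b y / s y" for a b c :: "real ^ 2 \<Rightarrow> complex" and y
  define r where "r y = z2 y / z1 y" for y
  define r1 where "r1 y = (z12 y * z1 y - z2 y * z11 y) / (z1 y * z1 y)" for y
  define r2 where "r2 y = (z22 y * z1 y - z2 y * z12 y) / (z1 y * z1 y)" for y
  define P where "P y = (z1 y * w2 y - z2 y * w1 y) / (s y * s y)" for y
  define c where "c y = z11 y / z1 y - 2 * w y * z1 y / s y" for y
  have Ds: "has_partial s i (z y * w1 y + z1 y * w y) y" "has_partial s j (z y * w2 y + z2 y * w y) y"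
    if "y \<in> S" for y
    unfolding s_def by (rule has_partial_add has_partial_const has_partial_mult D[OF that] refl | simp)+
  have Dr: "has_partial r i (r1 y) y" if "y \<in> S" for y
    unfolding r_def r1_def
    by (rule has_partial_rules D[OF that] refl nz[OF that])+
  have Im_r: "Im (r y) = 0" if "y \<in> S" for y
    using rank[OF that] by (simp add: r_def jet_defs)
  have Im_r1: "Im (r1 y) = 0" if "y \<in> S" for y
    using has_partial_linear_zero[OF bounded_linear_Im Dr[OF that] S(1) that Im_r] .
  have Re_P: "Re (P y) = 0" if "y \<in> S" for y
    using lagrangian[OF that] by (simp add: P_def jet_defs)
  have z2: "z2 y = r y * z1 y" if "y \<in> S" for y
    using nz[OF that] by (simp add: r_def)
  have z12: "z12 y = r1 y * z1 y + r y * z11 y" if "y \<in> S" for y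
    using nz[OF that] by (simp add: r_def r1_def field_simps)
  have z22: "z22 y = r2 y * z1 y + r y * z12 y" if "y \<in> S" for y
    using nz[OF that] by (simp add: r_def r2_def field_simps)
  have C0_P: "Im (c y) = 0 \<and> Im (P y) \<noteq> 0" if y: "y \<in> S" for y
  proof -
    define N where "N y = z1 y * w2 y - z2 y * w1 y" for y
    define Na where "Na = z1 y * w12 y + z11 y * w2 y - (z2 y * w11 y + z12 y * w1 y)"
    define Nb where "Nb = z1 y * w22 y + z12 y * w2 y - (z2 y * w12 y + z22 y * w1 y)"
    define sa where "sa = z y * w1 y + z1 y * w y"
    define sb where "sb = z y * w2 y + z2 y * w y"
    have N: "has_partial N i Na y" "has_partial N j Nb y"
      unfolding N_def Na_def Nb_def by (rule has_partial_rules D[OF y] refl)+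
    have quot: "has_partial P k ((n * s y - 2 * N y * d) / s y ^ 3) y"
      if "has_partial N k n y" "has_partial s k d y" for k n d
    proof -
      have "P = (\<lambda>y. N y / (s y * s y))" by (simp add: P_def N_def fun_eq_iff)
      moreover have "has_partial (\<lambda>y. N y / (s y * s y)) k ((n * s y - 2 * N y * d) / s y ^ 3) y"
        by (rule has_partial_divide[OF that(1) has_partial_mult[OF that(2,2) refl]])
          (use nz[OF y] in \<open>simp_all add: field_simps power3_eq_cube\<close>)
      ultimately show ?thesis by simp
    qed
    define Pa where "Pa = (Na * s y - 2 * N y * sa) / s y ^ 3"
    define Pb where "Pb = (Nb * s y - 2 * N y * sb) / s y ^ 3"
    have "has_partial P i Pa y" "has_partial P j Pb y"
      unfolding Pa_def Pb_def sa_def sb_def by (intro quot N Ds[OF y])+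
    then have Pab: "Re Pa = 0" "Re Pb = 0"
      using has_partial_linear_zero[of Re P, OF bounded_linear_Re _ S(1) y Re_P] by simp_all
    define \<rho> where "\<rho> = Re (r y)"
    have r: "r y = of_real \<rho>"
      using Im_r[OF y] by (simp add: \<rho>_def complex_eq_iff)
    define Q where "Q Az Aw = (Az * w1 y - Aw * z1 y) / (s y * s y)" for Az Aw
    let ?B11 = "b i i y" and ?B12 = "b j i y" and ?B22 = "b j j y"
    let ?z11 = "Az z1 z1 z11 y" and ?z12 = "Az z1 z2 z12 y" and ?z22 = "Az z2 z2 z22 y"
    let ?w11 = "Aw w1 w1 w11 y" and ?w12 = "Aw w1 w2 w12 y" and ?w22 = "Aw w2 w2 w22 y"
    have Q_lin: "Q (a + of_real t * b) (a' + of_real t * b') = Q a a' + of_real t * Q b b'" for a b a' b' t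
      by (simp add: Q_def algebra_simps add_divide_distrib diff_divide_distrib)
    \<comment> \<open>\<open>Q\<close> is the pairing with the first coordinate vector, which pairs to zero with itself. Up to
      multiples of that vector, the arguments below are \<open>\<nabla>\<^sub>1 V\<close> and then \<open>\<nabla>\<^sub>V V\<close>.\<close>
    have Q1: "Q (?z12 - r y * ?z11) (?w12 - r y * ?w11) = P y * c y - Pa"
      unfolding Q_def P_def c_def Pa_def Az_def Aw_def N_def Na_def sa_def
      unfolding z2[OF y] z12[OF y] using nz[OF y] by (rule vertical_derivative_mixed)
    have Q2: "Q (?z22 - 2 * r y * ?z12 + r y * r y * ?z11) (?w22 - 2 * r y * ?w12 + r y * r y * ?w11)
        = r y * Pa - Pb + r1 y * P y"
      unfolding Q_def P_def Pa_def Pb_def Az_def Aw_def N_def Na_def Nb_def sa_def sb_def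
      unfolding z2[OF y] z22[OF y] z12[OF y] using nz(1)[OF y] by (rule vertical_derivative_twice)
    have BQ: "?B11 = Re (Q ?z11 ?w11)" "?B12 = Re (Q ?z12 ?w12)" "?B22 = Re (Q ?z22 ?w22)"
      by (simp_all add: b[OF y] Q_def Az_def Aw_def jet_defs mult.commute mult.left_commute)
    have Re_real: "Re (of_real t * q) = t * Re q" for t q by simp
    have B: "?B12 - \<rho> * ?B11 = - Im (P y) * Im (c y)"
    proof -
      have "Q (?z12 - r y * ?z11) (?w12 - r y * ?w11) = Q ?z12 ?w12 - of_real \<rho> * Q ?z11 ?w11"
        using Q_lin[of ?z12 "-\<rho>" ?z11 ?w12 ?w11] by (simp add: r)
      then have "?B12 - \<rho> * ?B11 = Re (Q (?z12 - r y * ?z11) (?w12 - r y * ?w11))"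
        by (simp add: BQ)
      also have "\<dots> = - Im (P y) * Im (c y)"
        unfolding Q1 using Pab Re_P[OF y] by simp
      finally show ?thesis .
    qed
    have B': "?B22 - 2 * \<rho> * ?B12 + \<rho>\<^sup>2 * ?B11 = 0"
    proof -
      have "Q (?z22 - 2 * r y * ?z12 + r y * r y * ?z11) (?w22 - 2 * r y * ?w12 + r y * r y * ?w11)
          = Q ?z22 ?w22 - of_real (2 * \<rho>) * Q ?z12 ?w12 + of_real (\<rho>\<^sup>2) * Q ?z11 ?w11"
        using Q_lin[of ?z22 "-2*\<rho>" ?z12 ?w22 ?w12]
          Q_lin[of "?z22 - 2 * r y * ?z12" "\<rho>\<^sup>2" ?z11 "?w22 - 2 * r y * ?w12" ?w11]
        by (simp add: r power2_eq_square)
      then have "?B22 - 2 * \<rho> * ?B12 + \<rho>\<^sup>2 * ?B11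
          = Re (Q (?z22 - 2 * r y * ?z12 + r y * r y * ?z11) (?w22 - 2 * r y * ?w12 + r y * r y * ?w11))"
        by (simp only: BQ plus_complex.sel minus_complex.sel Re_real)
      also have "\<dots> = 0"
        unfolding Q2 using Pab Re_P[OF y] Im_r[OF y] Im_r1[OF y] by simp
      finally show ?thesis .
    qed
    have Im_real: "Im (of_real t * q) = t * Im q" for t q by simp
    define g11 where "g11 = g i i y"
    have g12: "g i j y = Im (P y) + \<rho> * g11"
    proof -
      have "(z1 y * w2 y + z2 y * w1 y) / (s y * s y)
          = P y + of_real \<rho> * ((z1 y * w1 y + z1 y * w1 y) / (s y * s y))"
        unfolding P_def z2[OF y] r by (simp add: field_simps nz[OF y])
      then show ?thesis unfolding g11_def g[OF y] jet_defs by (simp only: plus_complex.sel Im_real)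
    qed
    have g22: "g j j y = 2 * \<rho> * Im (P y) + \<rho>\<^sup>2 * g11"
    proof -
      have "(z2 y * w2 y + z2 y * w2 y) / (s y * s y)
          = of_real (2 * \<rho>) * P y + of_real (\<rho>\<^sup>2) * ((z1 y * w1 y + z1 y * w1 y) / (s y * s y))"
        unfolding P_def z2[OF y] r by (simp add: field_simps nz[OF y] power2_eq_square)
      then show ?thesis unfolding g11_def g[OF y] jet_defs by (simp only: plus_complex.sel Im_real)
    qed
    have "Im (P y) \<noteq> 0"
      using nondegenerate[OF y] unfolding g12 g22 g11_def[symmetric]
      by (auto simp: power2_eq_square algebra_simps)
    moreover have "2 * (Im (P y))\<^sup>2 * Im (c y) = 0"
    proof -
      have "0 = g11 * (?B22 - 2 * \<rho> * ?B12 + \<rho>\<^sup>2 * ?B11) - 2 * Im (P y) * (?B12 - \<rho> * ?B11)"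
        using H[OF y] unfolding g12 g22 g11_def[symmetric]
        by (simp add: power2_eq_square algebra_simps)
      then show ?thesis unfolding B B' by (simp add: power2_eq_square)
    qed
    ultimately show ?thesis by simp
  qed
  then have C0: "Im (c y) = 0" and P_nz: "Im (P y) \<noteq> 0" if "y \<in> S" for y
    using that by auto
  \<comment> \<open>It remains to differentiate \<open>Im c = 0\<close> along \<open>V\<close> at one point. The derivatives of \<open>r\<close>
    contribute the real number \<open>r11 + r1 c\<close>, and the change of \<open>w\<close> along \<open>V\<close> contributes \<open>-2 P\<close>.\<close>
  define r11 where "r11 =
    ((z112 y0 * z1 y0 + z12 y0 * z11 y0 - (z2 y0 * z111 y0 + z12 y0 * z11 y0)) * (z1 y0 * z1 y0)
     - (z12 y0 * z1 y0 - z2 y0 * z11 y0) * (z1 y0 * z11 y0 + z11 y0 * z1 y0)) / (z1 y0 * z1 y0 * (z1 y0 * z1 y0))"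
  define ca where "ca = (z111 y0 * z1 y0 - z11 y0 * z11 y0) / (z1 y0 * z1 y0)
    - ((2 * w y0 * z11 y0 + 2 * w1 y0 * z1 y0) * s y0
       - 2 * w y0 * z1 y0 * (z y0 * w1 y0 + z1 y0 * w y0)) / (s y0 * s y0)"
  define cb where "cb = (z112 y0 * z1 y0 - z11 y0 * z12 y0) / (z1 y0 * z1 y0)
    - ((2 * w y0 * z12 y0 + 2 * w2 y0 * z1 y0) * s y0
       - 2 * w y0 * z1 y0 * (z y0 * w2 y0 + z2 y0 * w y0)) / (s y0 * s y0)"
  have "has_partial r1 i r11 y0"
    unfolding r1_def r11_def
    by (rule has_partial_rules D[OF S(2)] refl | use nz(2)[OF S(2)] in simp)+
  then have "Im r11 = 0"
    using has_partial_linear_zero[of Im r1, OF bounded_linear_Im _ S Im_r1] by simp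
  have "has_partial c i ca y0"
    unfolding c_def ca_def
    by (rule has_partial_rules D[OF S(2)] Ds[OF S(2)] nz[OF S(2)] refl | simp)+
  then have "Im ca = 0"
    using has_partial_linear_zero[of Im c, OF bounded_linear_Im _ S C0] by simp
  have "has_partial c j cb y0"
    unfolding c_def cb_def
    by (rule has_partial_rules D[OF S(2)] Ds[OF S(2)] nz[OF S(2)] refl | simp)+
  then have "Im cb = 0"
    using has_partial_linear_zero[of Im c, OF bounded_linear_Im _ S C0] by simp
  have "cb - r y0 * ca = r11 + r1 y0 * c y0 - 2 * P y0"
    using nz[OF S(2)]
    unfolding cb_def ca_def r11_def r1_def r_def c_def P_def s_def
    by (simp add: divide_simps) algebra
  from arg_cong[OF this, of Im] have "Im (P y0) = 0"
    using \<open>Im r11 = 0\<close> \<open>Im ca = 0\<close> \<open>Im cb = 0\<close> C0[OF S(2)] Im_r[OF S(2)] Im_r1[OF S(2)] by simp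
  then show False using P_nz[OF S(2)] by simp
qed

section \<open>Connection and mean curvature in coordinates\<close>

lemma neutral_metric_eq_Im:
  "neutral_metric m u v =
     Im ((fst u * cnj (snd v) + fst v * cnj (snd u)) / (1 + fst m * cnj (snd m))\<^sup>2)"
proof -
  define q where "q = sym_prod d\<mu>1 d\<mu>2_bar u v / (1 + fst m * cnj (snd m))\<^sup>2"
  have "sym_prod d\<mu>1_bar d\<mu>2 u v / (1 + cnj (fst m) * snd m)\<^sup>2 = cnj q"
    by (simp add: q_def sym_prod_def)
  then have "neutral_metric m u v = Im (2 * q)"
    by (simp add: neutral_metric_def q_def[symmetric])
  also have "2 * q = (fst u * cnj (snd v) + fst v * cnj (snd u)) / (1 + fst m * cnj (snd m))\<^sup>2"
    by (simp add: q_def sym_prod_def add_divide_distrib mult.commute)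
  finally show ?thesis .
qed

lemma symplectic_form_eq_Re:
  "symplectic_form m u v =
     - 2 * Re ((fst u * cnj (snd v) - cnj (snd u) * fst v) / (1 + fst m * cnj (snd m))\<^sup>2)"
proof -
  define q where "q = wedge d\<mu>1 d\<mu>2_bar u v / (1 + fst m * cnj (snd m))\<^sup>2"
  have "wedge d\<mu>1_bar d\<mu>2 u v / (1 + cnj (fst m) * snd m)\<^sup>2 = cnj q"
    by (simp add: q_def wedge_def)
  then have "symplectic_form m u v = - 2 * Re q"
    by (simp add: symplectic_form_def q_def[symmetric])
  then show ?thesis by (simp add: q_def wedge_def)
qed

text \<open>Christoffel symbols of the second kind. The metric is twice the imaginary part of the holomorphic
  metric \<open>dz dw / (1 + z w)\<^sup>2\<close> with \<open>z = \<mu>\<^sub>1\<close> and \<open>w = cnj \<mu>\<^sub>2\<close>, hence its connection is the holomorphic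
  one, and its only symbols are the logarithmic derivatives of the conformal factor.\<close>

definition christoffel2 ::
  "complex \<times> complex \<Rightarrow> complex \<times> complex \<Rightarrow> complex \<times> complex \<Rightarrow> complex \<times> complex" where
  "christoffel2 m u v =
     (- 2 * cnj (snd m) * fst u * fst v / (1 + fst m * cnj (snd m)),
      cnj (- 2 * fst m * cnj (snd u) * cnj (snd v) / (1 + fst m * cnj (snd m))))"

lemma frechet_derivative_neutral_metric:
  assumes "1 + fst m * cnj (snd m) \<noteq> 0"
  shows "frechet_derivative (\<lambda>p. neutral_metric p v w) (at m) u =
    Im (- 2 * (fst v * cnj (snd w) + fst w * cnj (snd v))
          * (fst u * cnj (snd m) + fst m * cnj (snd u)) / (1 + fst m * cnj (snd m)) ^ 3)"
proof -
  define K where "K = fst v * cnj (snd w) + fst w * cnj (snd v)"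
  have quotient: "(0 * (S * S) - K * (S * x + x * S)) / ((S * S) * (S * S)) = - 2 * K * x / S ^ 3"
    if "S \<noteq> 0" for S x
    using that by (simp add: field_simps power3_eq_cube)
  have s: "((\<lambda>p. 1 + fst p * cnj (snd p)) has_derivative
      (\<lambda>u. fst u * cnj (snd m) + fst m * cnj (snd u))) (at m)"
    by (auto intro!: derivative_eq_intros simp: add.commute)
  have sq: "((\<lambda>p. (1 + fst p * cnj (snd p)) * (1 + fst p * cnj (snd p))) has_derivative
      (\<lambda>u. (1 + fst m * cnj (snd m)) * (fst u * cnj (snd m) + fst m * cnj (snd u))
         + (fst u * cnj (snd m) + fst m * cnj (snd u)) * (1 + fst m * cnj (snd m)))) (at m)"
    by (rule has_derivative_mult[OF s s])
  have "((\<lambda>p. K / ((1 + fst p * cnj (snd p)) * (1 + fst p * cnj (snd p)))) has_derivative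
      (\<lambda>u. - 2 * K * (fst u * cnj (snd m) + fst m * cnj (snd u)) / (1 + fst m * cnj (snd m)) ^ 3)) (at m)"
    by (rule has_derivative_eq_rhs[OF has_derivative_divide'[OF has_derivative_const sq]])
      (use assms in \<open>simp_all only: quotient mult_eq_0_iff simp_thms\<close>)
  from bounded_linear.has_derivative[OF bounded_linear_Im this]
  have "((\<lambda>p. neutral_metric p v w) has_derivative
      (\<lambda>u. Im (- 2 * K * (fst u * cnj (snd m) + fst m * cnj (snd u)) / (1 + fst m * cnj (snd m)) ^ 3))) (at m)"
    by (simp add: neutral_metric_eq_Im K_def power2_eq_square)
  from fun_cong[OF frechet_derivative_at[OF this], of u] show ?thesis
    unfolding K_def by (rule sym)
qed

lemma christoffel1_eq:
  assumes s: "1 + fst m * cnj (snd m) \<noteq> 0"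
  shows "christoffel1 m u v w = neutral_metric m (christoffel2 m u v) w"
proof -
  define S where "S = 1 + fst m * cnj (snd m)"
  have "christoffel1 m u v w = Im ((- 2 * (fst v * cnj (snd w) + fst w * cnj (snd v))
          * (fst u * cnj (snd m) + fst m * cnj (snd u)) / S ^ 3
      + - 2 * (fst u * cnj (snd w) + fst w * cnj (snd u))
          * (fst v * cnj (snd m) + fst m * cnj (snd v)) / S ^ 3
      - - 2 * (fst u * cnj (snd v) + fst v * cnj (snd u))
          * (fst w * cnj (snd m) + fst m * cnj (snd w)) / S ^ 3) / 2)"
    unfolding christoffel1_def frechet_derivative_neutral_metric[OF s] S_def[symmetric] by simp
  also have "\<dots> = neutral_metric m (christoffel2 m u v) w"
    unfolding neutral_metric_eq_Im christoffel2_def fst_conv snd_conv complex_cnj_cnj S_def[symmetric]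
    using s[folded S_def]
    by (intro arg_cong[of _ _ Im]) (simp add: field_simps power3_eq_cube power2_eq_square)
  finally show ?thesis .
qed

lemma neutral_metric_add_left:
  "neutral_metric m (u + u') v = neutral_metric m u v + neutral_metric m u' v"
  by (simp add: neutral_metric_eq_Im algebra_simps add_divide_distrib)

lemma neutral_metric_nondegenerate:
  assumes s: "1 + fst m * cnj (snd m) \<noteq> 0"
    and eq: "\<And>w. neutral_metric m u w = neutral_metric m v w"
  shows "u = v"
proof -
  let ?s2 = "(1 + fst m * cnj (snd m))\<^sup>2"
  have s2: "?s2 \<noteq> 0" using s by simp
  have Im_eqD: "c = d" if Im_eq: "\<And>x. Im (c * x) = Im (d * x)" for c d
    using Im_eq[of 1] Im_eq[of \<i>] by (simp add: complex_eq_iff)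
  have "neutral_metric m p (x * ?s2, 0) = Im (cnj (snd p) * x)" for p x
    unfolding neutral_metric_eq_Im using s2 by (simp del: power_eq_0_iff add: mult.commute)
  with eq have "cnj (snd u) = cnj (snd v)" by (intro Im_eqD) metis
  moreover have "neutral_metric m p (0, cnj (x * ?s2)) = Im (fst p * x)" for p x
    unfolding neutral_metric_eq_Im fst_conv snd_conv complex_cnj_cnj using s2
    by (simp del: power_eq_0_iff add: mult.assoc[symmetric])
  with eq have "fst u = fst v" by (intro Im_eqD) metis
  ultimately show ?thesis by (simp add: prod_eq_iff)
qed

lemma cov_deriv_eq:
  assumes s: "1 + fst (F y) * cnj (snd (F y)) \<noteq> 0"
  shows "cov_deriv F i j y = partial_deriv (partial_deriv F j) i y
    + christoffel2 (F y) (partial_deriv F i y) (partial_deriv F j y)"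
  unfolding cov_deriv_def christoffel1_eq[OF s] neutral_metric_add_left[symmetric]
  by (rule the_equality, simp, rule neutral_metric_nondegenerate[OF s], erule spec)

lemma linear_symplectic_form: "linear (\<lambda>u. symplectic_form m u v)"
proof (rule linearI)
  have Re_real: "Re (of_real t * q) = t * Re q" for t q by simp
  let ?Q = "\<lambda>u. (fst u * cnj (snd v) - cnj (snd u) * fst v) / (1 + fst m * cnj (snd m))\<^sup>2"
  fix u u' and t :: real
  show "symplectic_form m (u + u') v = symplectic_form m u v + symplectic_form m u' v"
    by (simp add: symplectic_form_eq_Re algebra_simps add_divide_distrib diff_divide_distrib)
  have "?Q (t *\<^sub>R u) = of_real t * ?Q u"
    by (simp add: scaleR_conv_of_real right_diff_distrib mult.assoc)
  then show "symplectic_form m (t *\<^sub>R u) v = t *\<^sub>R symplectic_form m u v"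
    unfolding symplectic_form_eq_Re by (simp only: Re_real) simp
qed

text \<open>On a Lagrangian surface the symplectic form does not see tangential parts. This turns the vanishing of
  the mean curvature into an equation on covariant derivatives without any projection.\<close>

lemma symplectic_form_normal_part:
  assumes "\<And>k. symplectic_form (F y) (partial_deriv F k y) v = 0"
  shows "symplectic_form (F y) (normal_part F y V) v = symplectic_form (F y) V v"
proof -
  interpret linear "\<lambda>u. symplectic_form (F y) u v" by (rule linear_symplectic_form)
  show ?thesis unfolding normal_part_def by (simp add: diff sum scale assms)
qed

lemma symplectic_form_mean_curvature:
  assumes "\<And>k. symplectic_form (F y) (partial_deriv F k y) v = 0"
  shows "symplectic_form (F y) (mean_curvature_vector F y) v =
    (1/2) * (\<Sum>i\<in>UNIV. \<Sum>j\<in>UNIV.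
      matrix_inv (induced_metric F y) $ i $ j * symplectic_form (F y) (cov_deriv F i j y) v)"
proof -
  interpret linear "\<lambda>u. symplectic_form (F y) u v" by (rule linear_symplectic_form)
  show ?thesis
    unfolding mean_curvature_vector_def second_fundamental_form_def
    by (simp add: sum scale symplectic_form_normal_part[OF assms])
qed

lemma UNIV_2_eq: "i \<noteq> j \<Longrightarrow> (UNIV :: 2 set) = {i, j}"
  using exhaust_2[of i] exhaust_2[of j] by (auto simp: UNIV_2)

text \<open>Cramer's rule, in a form that is symmetric in the two indices: \<open>i\<close> will be an index for which the
  partial derivative of \<open>\<mu>\<^sub>1\<close> does not vanish.\<close>

lemma trace_matrix_inv_2:
  fixes g :: "real ^ 2 ^ 2" and i j :: 2
  assumes "i \<noteq> j" "invertible g" "g $ j $ i = g $ i $ j"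
  shows "(\<Sum>a\<in>UNIV. \<Sum>b\<in>UNIV. matrix_inv g $ a $ b * B a b) * (g $ i $ i * g $ j $ j - (g $ i $ j)\<^sup>2)
    = g $ j $ j * B i i - g $ i $ j * (B i j + B j i) + g $ i $ i * B j j"
    and "g $ i $ i * g $ j $ j \<noteq> (g $ i $ j)\<^sup>2"
proof -
  note [simp] = UNIV_2_eq[OF assms(1)]
  define m where "m = matrix_inv g"
  have "(m ** g) $ a $ b = (if a = b then 1 else 0)" for a b
    using someI_ex[OF assms(2)[unfolded invertible_def]] by (simp add: m_def matrix_inv_def mat_def)
  from this[of i i] this[of i j] this[of j i] this[of j j]
  have e: "m $ i $ i * g $ i $ i + m $ i $ j * g $ i $ j = 1"
    "m $ i $ i * g $ i $ j + m $ i $ j * g $ j $ j = 0"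
    "m $ j $ i * g $ i $ i + m $ j $ j * g $ i $ j = 0"
    "m $ j $ i * g $ i $ j + m $ j $ j * g $ j $ j = 1"
    using assms(1,3) by (simp_all add: matrix_matrix_mult_def)
  define d where "d = g $ i $ i * g $ j $ j - (g $ i $ j)\<^sup>2"
  have m: "m $ i $ i * d = g $ j $ j" "m $ i $ j * d = - g $ i $ j"
    "m $ j $ i * d = - g $ i $ j" "m $ j $ j * d = g $ i $ i"
  proof -
    have "m $ i $ i * d = g $ j $ j * (m $ i $ i * g $ i $ i + m $ i $ j * g $ i $ j)
        - g $ i $ j * (m $ i $ i * g $ i $ j + m $ i $ j * g $ j $ j)"
      "m $ i $ j * d = g $ i $ i * (m $ i $ i * g $ i $ j + m $ i $ j * g $ j $ j)
        - g $ i $ j * (m $ i $ i * g $ i $ i + m $ i $ j * g $ i $ j)"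
      "m $ j $ i * d = g $ j $ j * (m $ j $ i * g $ i $ i + m $ j $ j * g $ i $ j)
        - g $ i $ j * (m $ j $ i * g $ i $ j + m $ j $ j * g $ j $ j)"
      "m $ j $ j * d = g $ i $ i * (m $ j $ i * g $ i $ j + m $ j $ j * g $ j $ j)
        - g $ i $ j * (m $ j $ i * g $ i $ i + m $ j $ j * g $ i $ j)"
      by (simp_all add: d_def algebra_simps power2_eq_square)
    then show "m $ i $ i * d = g $ j $ j" "m $ i $ j * d = - g $ i $ j"
      "m $ j $ i * d = - g $ i $ j" "m $ j $ j * d = g $ i $ i"
      unfolding e by simp_all
  qed
  show "g $ i $ i * g $ j $ j \<noteq> (g $ i $ j)\<^sup>2"
  proof
    assume "g $ i $ i * g $ j $ j = (g $ i $ j)\<^sup>2"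
    then have "d = 0" by (simp add: d_def)
    with m e(1) show False by auto
  qed
  have "(\<Sum>a\<in>UNIV. \<Sum>b\<in>UNIV. m $ a $ b * B a b) * d
      = (m $ i $ i * d) * B i i + (m $ i $ j * d) * B i j + (m $ j $ i * d) * B j i + (m $ j $ j * d) * B j j"
    using assms(1) by (simp add: algebra_simps)
  also have "\<dots> = g $ j $ j * B i i - g $ i $ j * (B i j + B j i) + g $ i $ i * B j j"
    unfolding m by (simp add: algebra_simps)
  finally show "(\<Sum>a\<in>UNIV. \<Sum>b\<in>UNIV. matrix_inv g $ a $ b * B a b) * (g $ i $ i * g $ j $ j - (g $ i $ j)\<^sup>2)
    = g $ j $ j * B i i - g $ i $ j * (B i j + B j i) + g $ i $ i * B j j"
    unfolding m_def d_def .
qed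

lemma rank_one_linear:
  fixes L :: "real ^ 2 \<Rightarrow> complex"
  assumes "linear L" "dim (range L) = 1"
  shows "\<exists>i. L (axis i 1) \<noteq> 0" and "Im (L u / L v) = 0"
proof -
  show "\<exists>i. L (axis i 1) \<noteq> 0"
  proof (rule ccontr)
    assume "\<not> ?thesis"
    then have "L b = 0" if "b \<in> Basis" for b using that by (auto simp: Basis_vec_def)
    then have "L = (\<lambda>x. 0)"
      using linear_eq_stdbasis[OF assms(1) linear_zero] by blast
    then have "range L = {0}" by auto
    with assms(2) show False by simp
  qed
  obtain B where "B \<subseteq> range L" "range L \<subseteq> span B" "card B = 1"
    using basis_exists[of "range L"] assms(2) by metis
  then obtain x where "range L \<subseteq> span {x}" by (metis card_1_singletonE)
  then have "L u \<in> span {x}" "L v \<in> span {x}" by auto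
  then obtain a b where "L u = a *\<^sub>R x" "L v = b *\<^sub>R x"
    by (auto simp: span_singleton)
  then show "Im (L u / L v) = 0"
    by (cases "x = 0") (simp_all add: scaleR_conv_of_real flip: of_real_divide)
qed

section \<open>Surfaces of rank one\<close>

text \<open>The local statement: near a point where \<open>\<partial>\<^sub>i \<mu>\<^sub>1\<close> does not vanish, the hypotheses on the
  surface become the relations between partial derivatives that were shown to be contradictory.\<close>

lemma no_rank_one_maximal_Lagrangian_patch:
  fixes F :: "real ^ 2 \<Rightarrow> complex \<times> complex"
  assumes S: "open S" "S \<noteq> {}"
    and F: "Ck_on 3 F S"
    and s: "\<And>y. y \<in> S \<Longrightarrow> 1 + fst (F y) * cnj (snd (F y)) \<noteq> 0"
    and lagrangian: "\<And>y u v. y \<in> S \<Longrightarrow>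
      symplectic_form (F y) (frechet_derivative F (at y) u) (frechet_derivative F (at y) v) = 0"
    and nondegenerate: "\<And>y. y \<in> S \<Longrightarrow> invertible (induced_metric F y)"
    and maximal: "\<And>y. y \<in> S \<Longrightarrow> mean_curvature_vector F y = 0"
    and rank: "\<And>y. y \<in> S \<Longrightarrow> dim (range (frechet_derivative (\<lambda>y. fst (F y)) (at y))) = 1"
  shows False
proof -
  define E where "E k = partial_deriv F k" for k
  define E2 where "E2 k l = partial_deriv (E l) k" for k l
  define z where "z y = fst (F y)" for y
  define w where "w y = cnj (snd (F y))" for y
  define zd where "zd k y = fst (E k y)" for k y
  define wd where "wd k y = cnj (snd (E k y))" for k y
  define zdd where "zdd k l y = fst (E2 k l y)" for k l y
  define wdd where "wdd k l y = cnj (snd (E2 k l y))" for k l y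
  have F3: "Ck_on (Suc (Suc (Suc 0))) F S" using F by (simp add: numeral_3_eq_3)
  have CE: "Ck_on (Suc (Suc 0)) (E k) S" for k
    unfolding E_def by (rule Ck_on_partial_deriv[OF F3])
  have CE2: "Ck_on (Suc 0) (E2 k l) S" for k l
    unfolding E2_def by (rule Ck_on_partial_deriv[OF CE])
  have E2_commute: "E2 k l y = E2 l k y" if "y \<in> S" for k l y
    unfolding E2_def E_def by (rule partial_deriv_commute[OF F3 S(1) that])
  have bl: "bounded_linear (\<lambda>p. cnj (snd p))"
    by (intro bounded_linear_compose[OF bounded_linear_cnj] bounded_linear_snd)
  have DF: "has_partial F k (E k y) y" if "y \<in> S" for k y
    unfolding E_def by (rule has_partial_partial_deriv[OF F3 that])
  have DE: "has_partial (E l) k (E2 k l y) y" if "y \<in> S" for k l y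
    unfolding E2_def by (rule has_partial_partial_deriv[OF CE that])
  have DE2: "has_partial (E2 l m) k (partial_deriv (E2 l m) k y) y" if "y \<in> S" for k l m y
    by (rule has_partial_partial_deriv[OF CE2 that])
  have Dz: "has_partial z k (zd k y) y" and Dw: "has_partial w k (wd k y) y" if "y \<in> S" for k y
    unfolding z_def w_def zd_def wd_def
    by (intro has_partial_linear[OF bounded_linear_fst] has_partial_linear[OF bl] DF that)+
  have Dzd: "has_partial (zd l) k (zdd k l y) y" and Dwd: "has_partial (wd l) k (wdd k l y) y"
    if "y \<in> S" for k l y
    unfolding zd_def wd_def zdd_def wdd_def
    by (intro has_partial_linear[OF bounded_linear_fst] has_partial_linear[OF bl] DE that)+
  have zdd_commute: "zdd k l y = zdd l k y" "wdd k l y = wdd l k y" if "y \<in> S" for k l y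
    unfolding zdd_def wdd_def E2_commute[OF that, of k l] by (rule refl)+

  have dz': "((\<lambda>y. fst (F y)) has_derivative (\<lambda>v. fst (frechet_derivative F (at y) v))) (at y)"
    if "y \<in> S" for y
    by (rule bounded_linear.has_derivative[OF bounded_linear_fst Ck_on_SucD[OF F3 that]])
  have dz: "frechet_derivative (\<lambda>y. fst (F y)) (at y) = (\<lambda>v. fst (frechet_derivative F (at y) v))"
    if "y \<in> S" for y
    by (rule frechet_derivative_at[OF dz'[OF that], symmetric])
  have zd: "zd k y = frechet_derivative (\<lambda>y. fst (F y)) (at y) (axis k 1)" if "y \<in> S" for k y
    by (simp add: zd_def E_def partial_deriv_def dz[OF that])
  have lin: "linear (frechet_derivative (\<lambda>y. fst (F y)) (at y))" if "y \<in> S" for y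
    unfolding dz[OF that] by (rule has_derivative_linear[OF dz'[OF that]])
  obtain y0 where y0: "y0 \<in> S" using S(2) by blast
  obtain i where i: "zd i y0 \<noteq> 0"
    using rank_one_linear(1)[OF lin[OF y0] rank[OF y0]] zd[OF y0] by auto
  obtain j :: 2 where ij: "i \<noteq> j" by (metis zero_neq_one)
  define T where "T = {y \<in> S. zd i y \<noteq> 0}"
  have "continuous_on S (zd i)"
    unfolding zd_def by (intro continuous_intros Ck_on_continuous[OF CE])
  then have "open (S \<inter> zd i -` (- {0}))"
    using S(1) by (rule continuous_open_preimage) auto
  moreover have "T = S \<inter> zd i -` (- {0})" by (auto simp: T_def)
  ultimately have "open T" by simp
  have "y0 \<in> T" using y0 i by (simp add: T_def)

  have tangent: "symplectic_form (F y) (E k y) (E l y) = 0" if "y \<in> S" for k l y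
    unfolding E_def partial_deriv_def by (rule lagrangian[OF that])
  have metric: "induced_metric F y $ k $ l
      = Im ((zd k y * wd l y + zd l y * wd k y) / ((1 + z y * w y) * (1 + z y * w y)))" for y k l
    by (simp add: induced_metric_def neutral_metric_eq_Im E_def z_def w_def zd_def wd_def power2_eq_square)
  have metric_sym: "induced_metric F y $ k $ l = induced_metric F y $ l $ k" for y k l
    unfolding metric by (simp add: add.commute)
  define A where "A k l y = symplectic_form (F y) (cov_deriv F k l y) (E i y)" for k l y
  define B where "B k l y = Re (((zdd k l y - 2 * w y * zd k y * zd l y / (1 + z y * w y)) * wd i y
      - (wdd k l y - 2 * z y * wd k y * wd l y / (1 + z y * w y)) * zd i y)
      / ((1 + z y * w y) * (1 + z y * w y)))" for k l y
  have A: "A k l y = - 2 * B k l y" if "y \<in> S" for k l y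
    unfolding A_def B_def cov_deriv_eq[of F y, OF s[OF that]] symplectic_form_eq_Re
    by (simp add: christoffel2_def zd_def wd_def zdd_def wdd_def z_def w_def E_def[symmetric]
        E2_def[symmetric] power2_eq_square)
  have H: "induced_metric F y $ j $ j * B i i y - 2 * induced_metric F y $ i $ j * B j i y
      + induced_metric F y $ i $ i * B j j y = 0" if y: "y \<in> S" for y
  proof -
    have "(\<Sum>a\<in>UNIV. \<Sum>b\<in>UNIV. matrix_inv (induced_metric F y) $ a $ b * A a b y) = 0"
      using symplectic_form_mean_curvature[of F y "E i y"] tangent[OF y, of _ i] maximal[OF y]
        linear_0[OF linear_symplectic_form]
      by (simp add: A_def E_def)
    with trace_matrix_inv_2(1)[OF ij nondegenerate[OF y] metric_sym, of "\<lambda>a b. A a b y"]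
    have "induced_metric F y $ j $ j * A i i y
        - induced_metric F y $ i $ j * (A i j y + A j i y) + induced_metric F y $ i $ i * A j j y = 0"
      by simp
    moreover have "B i j y = B j i y"
      unfolding B_def zdd_commute[OF y, of i j] by (simp add: mult_ac)
    ultimately show ?thesis unfolding A[OF y] by (simp add: algebra_simps)
  qed
  \<comment> \<open>\<open>\<partial>\<^sub>i \<partial>\<^sub>j (\<partial>\<^sub>i F) = \<partial>\<^sub>j \<partial>\<^sub>i (\<partial>\<^sub>i F)\<close>: the same third derivative occurs in both places.\<close>
  have third: "has_partial (zdd j i) i (fst (partial_deriv (E2 i i) j y)) y" if "y \<in> S" for y
    using has_partial_linear[OF bounded_linear_fst DE2[OF that]]
      partial_deriv_commute[OF CE S(1) that, of i i j]
    unfolding zdd_def E2_def by metis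
  show False
  proof (rule rank_one_jets_contradiction[OF refl, where z = z and w = w and zd = zd and wd = wd
        and zdd = zdd and wdd = wdd and i = i and j = j
        and g = "\<lambda>k l y. induced_metric F y $ k $ l" and b = B, OF metric B_def \<open>open T\<close> \<open>y0 \<in> T\<close>])
    fix y assume "y \<in> T"
    then have y: "y \<in> S" "zd i y \<noteq> 0" by (auto simp: T_def)
    show "1 + z y * w y \<noteq> 0" using s[OF y(1)] by (simp add: z_def w_def)
    show "zd i y \<noteq> 0" by fact
    show "has_partial z k (zd k y) y" "has_partial w k (wd k y) y" for k
      by (rule Dz Dw y(1))+
    show "has_partial (zd l) k (zdd k l y) y" "has_partial (wd l) k (wdd k l y) y" for k l
      by (rule Dzd Dwd y(1))+
    show "zdd k l y = zdd l k y" "wdd k l y = wdd l k y" for k l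
      by (rule zdd_commute[OF y(1)])+
    show "has_partial (zdd i i) i (fst (partial_deriv (E2 i i) i y)) y"
      "has_partial (zdd i i) j (fst (partial_deriv (E2 i i) j y)) y"
      unfolding zdd_def by (rule has_partial_linear[OF bounded_linear_fst] DE2 y(1))+
    show "has_partial (zdd j i) i (fst (partial_deriv (E2 i i) j y)) y"
      by (rule third[OF y(1)])
    show "Im (zd j y / zd i y) = 0"
      unfolding zd[OF y(1)] by (rule rank_one_linear(2)[OF lin[OF y(1)] rank[OF y(1)]])
    show "Re ((zd i y * wd j y - zd j y * wd i y) / ((1 + z y * w y) * (1 + z y * w y))) = 0"
      using tangent[OF y(1), of i j]
      by (simp add: symplectic_form_eq_Re zd_def wd_def z_def w_def power2_eq_square mult.commute)
    show "induced_metric F y $ i $ i * induced_metric F y $ j $ j \<noteq> (induced_metric F y $ i $ j)\<^sup>2"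
      by (rule trace_matrix_inv_2(2)[OF ij nondegenerate[OF y(1)] metric_sym])
    show "induced_metric F y $ j $ j * B i i y - 2 * induced_metric F y $ i $ j * B j i y
      + induced_metric F y $ i $ i * B j j y = 0"
      by (rule H[OF y(1)])
  qed
qed

theorem proposition5:
  shows "\<not> (\<exists>(X :: 'a topology) (A :: 'a chart set) (f :: 'a \<Rightarrow> cp1 \<times> cp1).
    smooth_surface X A \<and> immersion_LH3 X A f \<and> lagrangian A f \<and> maximal A f \<and> of_rank X A f 1)"
proof (rule notI, elim exE conjE)
  fix X :: "'a topology" and A :: "'a chart set" and f :: "'a \<Rightarrow> cp1 \<times> cp1"
  assume surface: "smooth_surface X A" and imm: "immersion_LH3 X A f" and lagr: "lagrangian A f"
    and max: "maximal A f" and rank: "of_rank X A f 1"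
  have f: "smooth_map_LH3 X A f" using imm by (simp add: immersion_LH3_def)
  obtain x where x: "x \<in> topspace X" using surface unfolding smooth_surface_def by blast
  then obtain k where k: "k \<in> A" "x \<in> fst k"
    using surface unfolding smooth_surface_def by force
  have "f x \<in> LH3" using f x by (auto simp: smooth_map_LH3_def)
  then obtain c where c: "f x \<in> geo_dom c" by (auto simp: LH3_eq_Un_geo_dom)
  let ?S = "coord_dom f k c" and ?F = "coord_rep f k c"
  have openin: "openin X (fst k)"
    and homeo: "homeomorphic_map (subtopology X (fst k)) (top_of_set (snd k ` fst k)) (snd k)"
    using surface k(1) unfolding smooth_surface_def case_prod_beta by blast+
  have inj: "inj_on (snd k) (fst k)"
    using homeomorphic_imp_injective_map[OF homeo] openin_subset[OF openin]
    by (simp add: inf.absorb2)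
  show False
  proof (rule no_rank_one_maximal_Lagrangian_patch[of ?S ?F])
    show "open ?S" "Ck_on 3 ?F ?S"
      using f k(1) by (auto simp: smooth_map_LH3_def smooth_on_def)
    show "?S \<noteq> {}" using k(2) c by (auto simp: coord_dom_def)
    fix y assume y: "y \<in> ?S"
    then obtain p where p: "p \<in> fst k" "f p \<in> geo_dom c" "y = snd k p"
      by (auto simp: coord_dom_def)
    have "?F y = geo_coord c (f p)"
      using p inj by (simp add: coord_rep_def inv_into_f_f)
    then have "?F y \<in> {(m1, m2). 1 + m1 * cnj m2 \<noteq> 0}"
      unfolding geo_coord_image[of c, symmetric] using p(2) by simp
    then show "1 + fst (?F y) * cnj (snd (?F y)) \<noteq> 0" by (simp only: mem_Collect_eq case_prod_beta not_False_eq_True)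
    show "symplectic_form (?F y) (frechet_derivative ?F (at y) u) (frechet_derivative ?F (at y) v) = 0" for u v
      using lagr k(1) y unfolding lagrangian_def by blast
    show "invertible (induced_metric ?F y)" "mean_curvature_vector ?F y = 0"
      using max k(1) y unfolding maximal_def by blast+
    have "p \<in> topspace X" using p(1) openin_subset[OF openin] by blast
    then have "has_rank_at A f p 1" using rank by (simp add: of_rank_def)
    then show "dim (range (frechet_derivative (\<lambda>y. fst (?F y)) (at y))) = 1"
      using k(1) p unfolding has_rank_at_def by blast
  qed
qed

end
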